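(* Let $X_1,\dots,X_n$ be random variables where $X_i$ takes values in a finite set of $k_i\ge 1$ possible values, and let a data sample of $N\ge 1$ joint observations of $(X_1,\dots,X_n)$ be given. Run the greedy dependency-forest algorithm (described in the context) on these data, with ties in the sorting broken in any way, and let $T$ be the output set of edges. Then the dependency forest model given by $T$ has the minimum description length among all dependency forest models over $X_1,\dots,X_n$; that is, for any choice of a root in each tree of the forest $T$, with resulting parent function $q$, and for every parent function $q'$ of a dependency forest on $X_1,\dots,X_n$, $$L(q)\le L(q').$$
   Context: **Dependency forest models.** A dependency forest on $X_1,\dots,X_n$ is given by a parent function $q:\{1,\dots,n\}\to\{0,1,\dots,n\}$ with $q(i)\neq i$ such that the directed links $X_{q(i)}\to X_i$ (for $q(i)\ne 0$) form a rooted forest (no cycles); $q(i)=0$ means $X_i$ is a root. The corresponding dependency forest model is the family of joint distributions $$P(X_1,\dots,X_n)=\prod_{i=1}^n P(X_i\mid X_{q(i)}),$$ where $P(X_i\mid X_0)$ means $P(X_i)$. **Description length.** $\hat P$ denotes maximum likelihood (empirical relative frequency) estimates from the $N$ observations, $f(\cdot)$ the observed frequencies, $\log$ is base $2$, and $0\log 0=0$. With the conventions $k_0=1$, $f(x_i,x_0)=f(x_i)$ and $\hat P(x_i\mid x_0)=\hat P(x_i)$, the description length (parameter description length plus data description length; the code length for the discrete model itself is taken to be the same for all models) of the dependency forest model with parent function $q$ is $$L(q)=\sum_{i=1}^n\left(\frac{(k_i-1)\,k_{q(i)}}{2}\log N-\sum_{x_i,\,x_{q(i)}} f(x_i,x_{q(i)})\log\hat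 P(x_i\mid x_{q(i)})\right).$$ **Statistic.** For $i\ne j$, $$\theta(X_i,X_j)=\hat I(X_i,X_j)-\frac{(k_i-1)(k_j-1)}{2N}\log N,$$ where $\hat I(X_i,X_j)=\hat H(X_i)-\hat H(X_i\mid X_j)$ is the empirical mutual information, $\hat H(X_i)=-\sum_{x_i}\hat P(x_i)\log\hat P(x_i)$, and $\hat H(X_i\mid X_j)=-\sum_{x_i,x_j}\hat P(x_i,x_j)\log\hat P(x_i\mid x_j)$. **Algorithm.** 1. $T:=\emptyset$; $V:=\{\{X_1\},\dots,\{X_n\}\}$. 2. Calculate $\theta(X_i,X_j)$ for all node pairs; sort the pairs in descending order of $\theta$ into a queue $Q$. 3. While $Q$ is nonempty and $\max_{(X_i,X_j)\in Q}\theta(X_i,X_j)>0$: remove a maximizing pair $(X_i,X_j)$ from $Q$; if $X_i$ and $X_j$ belong to different sets $W_1,W_2$ in $V$, replace $W_1$ and $W_2$ in $V$ by $W_1\cup W_2$ and add the edge $(X_i,X_j)$ to $T$. 4. Output $T$ as the (undirected) edge set of the dependency forest. *)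

theory Defs
  imports Complex_Main
begin

text \<open>
  The variables are indexed by \<open>1..n\<close>; index \<open>0\<close> is the dummy parent of a root.
  Variable \<open>i\<close> takes values in the finite set \<open>A i\<close>, so the number of its possible values is
  \<open>card (A i)\<close>. A sample is a list \<open>xs\<close> of joint observations, each a function from
  indices to values, and the sample size is \<open>length xs\<close>.
\<close>

definition dep_forest :: "nat \<Rightarrow> (nat \<Rightarrow> nat) \<Rightarrow> bool" where
  "dep_forest n q \<longleftrightarrow>
     (\<forall>i\<in>{1..n}. q i \<in> {0..n} \<and> q i \<noteq> i) \<and>
     acyclic {(q i, i) | i. i \<in> {1..n} \<and> q i \<noteq> 0}"

definition undirected_links :: "nat \<Rightarrow> (nat \<Rightarrow> nat) \<Rightarrow> nat set set" where
  "undirected_links n q = {{q i, i} | i. i \<in> {1..n} \<and> q i \<noteq> 0}"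


subsection \<open>Empirical frequencies and description length\<close>

definition freq :: "(nat \<Rightarrow> 'a) list \<Rightarrow> nat \<Rightarrow> 'a \<Rightarrow> real" where
  "freq xs i a = real (card {t. t < length xs \<and> (xs ! t) i = a})"

definition freq2 :: "(nat \<Rightarrow> 'a) list \<Rightarrow> nat \<Rightarrow> nat \<Rightarrow> 'a \<Rightarrow> 'a \<Rightarrow> real" where
  "freq2 xs i j a b = real (card {t. t < length xs \<and> (xs ! t) i = a \<and> (xs ! t) j = b})"

definition phat :: "(nat \<Rightarrow> 'a) list \<Rightarrow> nat \<Rightarrow> 'a \<Rightarrow> real" where
  "phat xs i a = freq xs i a / real (length xs)"

definition phat2 :: "(nat \<Rightarrow> 'a) list \<Rightarrow> nat \<Rightarrow> nat \<Rightarrow> 'a \<Rightarrow> 'a \<Rightarrow> real" where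
  "phat2 xs i j a b = freq2 xs i j a b / real (length xs)"

text \<open>
  The estimate of the probability that variable \<open>i\<close> is \<open>a\<close> given that variable \<open>j\<close> is \<open>b\<close>.
  If \<open>b\<close> is never observed this is \<open>0 / 0 = 0\<close>; below it then occurs only with the factor
  \<open>freq2 xs i j a b = 0\<close> or \<open>phat2 xs i j a b = 0\<close>, so that \<open>0 log 0 = 0\<close> holds as required.
\<close>

definition phat_cond :: "(nat \<Rightarrow> 'a) list \<Rightarrow> nat \<Rightarrow> nat \<Rightarrow> 'a \<Rightarrow> 'a \<Rightarrow> real" where
  "phat_cond xs i j a b = freq2 xs i j a b / freq xs j b"

definition num_vals :: "(nat \<Rightarrow> 'a set) \<Rightarrow> nat \<Rightarrow> real" where
  "num_vals A i = (if i = 0 then 1 else real (card (A i)))"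

definition log_likelihood_term ::
    "(nat \<Rightarrow> 'a set) \<Rightarrow> (nat \<Rightarrow> 'a) list \<Rightarrow> nat \<Rightarrow> nat \<Rightarrow> real" where
  "log_likelihood_term A xs i p =
     (if p = 0 then \<Sum>a\<in>A i. freq xs i a * log 2 (phat xs i a)
      else \<Sum>a\<in>A i. \<Sum>b\<in>A p. freq2 xs i p a b * log 2 (phat_cond xs i p a b))"

definition description_length ::
    "nat \<Rightarrow> (nat \<Rightarrow> 'a set) \<Rightarrow> (nat \<Rightarrow> 'a) list \<Rightarrow> (nat \<Rightarrow> nat) \<Rightarrow> real" where
  "description_length n A xs q =
     (\<Sum>i=1..n. (num_vals A i - 1) * num_vals A (q i) / 2 * log 2 (real (length xs))
                - log_likelihood_term A xs i (q i))"


subsection \<open>The statistic\<close>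

definition entropy_hat :: "(nat \<Rightarrow> 'a set) \<Rightarrow> (nat \<Rightarrow> 'a) list \<Rightarrow> nat \<Rightarrow> real" where
  "entropy_hat A xs i = - (\<Sum>a\<in>A i. phat xs i a * log 2 (phat xs i a))"

definition cond_entropy_hat :: "(nat \<Rightarrow> 'a set) \<Rightarrow> (nat \<Rightarrow> 'a) list \<Rightarrow> nat \<Rightarrow> nat \<Rightarrow> real" where
  "cond_entropy_hat A xs i j =
     - (\<Sum>a\<in>A i. \<Sum>b\<in>A j. phat2 xs i j a b * log 2 (phat_cond xs i j a b))"

definition mutual_info_hat :: "(nat \<Rightarrow> 'a set) \<Rightarrow> (nat \<Rightarrow> 'a) list \<Rightarrow> nat \<Rightarrow> nat \<Rightarrow> real" where
  "mutual_info_hat A xs i j = entropy_hat A xs i - cond_entropy_hat A xs i j"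

definition theta :: "(nat \<Rightarrow> 'a set) \<Rightarrow> (nat \<Rightarrow> 'a) list \<Rightarrow> nat \<Rightarrow> nat \<Rightarrow> real" where
  "theta A xs i j =
     mutual_info_hat A xs i j
     - (num_vals A i - 1) * (num_vals A j - 1) / (2 * real (length xs)) * log 2 (real (length xs))"


subsection \<open>The greedy algorithm\<close>

text \<open>
  A state consists of the queue \<open>Q\<close> of remaining pairs, the partition \<open>V\<close> of the nodes and the
  set \<open>T\<close> of undirected edges found so far. Each unordered pair of nodes is represented in the
  queue by \<open>(i, j)\<close> with \<open>i < j\<close>. Ties are broken nondeterministically, both in the initial
  order of the queue and in the choice of the maximizing pair.
\<close>

type_synonym greedy_state = "(nat \<times> nat) list \<times> nat set set \<times> nat set set"

definition sorted_queue :: "nat \<Rightarrow> (nat \<Rightarrow> nat \<Rightarrow> real) \<Rightarrow> (nat \<times> nat) list \<Rightarrow> bool" where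
  "sorted_queue n \<theta> Q \<longleftrightarrow>
     distinct Q \<and> set Q = {(i, j). 1 \<le> i \<and> i < j \<and> j \<le> n} \<and>
     sorted_wrt (\<lambda>(i, j) (i', j'). \<theta> i j \<ge> \<theta> i' j') Q"

definition max_weight :: "(nat \<Rightarrow> nat \<Rightarrow> real) \<Rightarrow> (nat \<times> nat) list \<Rightarrow> real" where
  "max_weight \<theta> Q = Max ((\<lambda>(i, j). \<theta> i j) ` set Q)"

definition loop_guard :: "(nat \<Rightarrow> nat \<Rightarrow> real) \<Rightarrow> (nat \<times> nat) list \<Rightarrow> bool" where
  "loop_guard \<theta> Q \<longleftrightarrow> Q \<noteq> [] \<and> max_weight \<theta> Q > 0"

inductive greedy_step :: "(nat \<Rightarrow> nat \<Rightarrow> real) \<Rightarrow> greedy_state \<Rightarrow> greedy_state \<Rightarrow> bool"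
  for \<theta> :: "nat \<Rightarrow> nat \<Rightarrow> real" where
  merge:
    "\<lbrakk>loop_guard \<theta> Q; (i, j) \<in> set Q; \<theta> i j = max_weight \<theta> Q;
      W1 \<in> V; W2 \<in> V; i \<in> W1; j \<in> W2; W1 \<noteq> W2\<rbrakk>
     \<Longrightarrow> greedy_step \<theta> (Q, V, T)
           (remove1 (i, j) Q, insert (W1 \<union> W2) (V - {W1, W2}), insert {i, j} T)"
| skip:
    "\<lbrakk>loop_guard \<theta> Q; (i, j) \<in> set Q; \<theta> i j = max_weight \<theta> Q;
      W \<in> V; i \<in> W; j \<in> W\<rbrakk>
     \<Longrightarrow> greedy_step \<theta> (Q, V, T) (remove1 (i, j) Q, V, T)"

definition greedy_output :: "nat \<Rightarrow> (nat \<Rightarrow> nat \<Rightarrow> real) \<Rightarrow> nat set set \<Rightarrow> bool" where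
  "greedy_output n \<theta> T \<longleftrightarrow>
     (\<exists>Q0 Q V. sorted_queue n \<theta> Q0 \<and>
        (greedy_step \<theta>)\<^sup>*\<^sup>* (Q0, (\<lambda>i. {i}) ` {1..n}, {}) (Q, V, T) \<and>
        \<not> loop_guard \<theta> Q)"


subsection \<open>Rooting an undirected forest\<close>

definition connected_in :: "nat set set \<Rightarrow> nat \<Rightarrow> nat \<Rightarrow> bool" where
  "connected_in T = (\<lambda>a b. {a, b} \<in> T)\<^sup>*\<^sup>*"

definition simple_path :: "nat set set \<Rightarrow> nat list \<Rightarrow> bool" where
  "simple_path T ps \<longleftrightarrow> distinct ps \<and> successively (\<lambda>a b. {a, b} \<in> T) ps"

definition root_choice :: "nat \<Rightarrow> nat set set \<Rightarrow> nat set \<Rightarrow> bool" where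
  "root_choice n T R \<longleftrightarrow>
     R \<subseteq> {1..n} \<and> (\<forall>i\<in>{1..n}. \<exists>!r. r \<in> R \<and> connected_in T i r)"

text \<open>
  The parent of a non-root node \<open>i\<close> is the second node on a path in \<open>T\<close> from \<open>i\<close> to
  the root of its tree.
\<close>

definition parent_function :: "nat \<Rightarrow> nat set set \<Rightarrow> nat set \<Rightarrow> (nat \<Rightarrow> nat) \<Rightarrow> bool" where
  "parent_function n T R q \<longleftrightarrow>
     (\<forall>i\<in>{1..n}. if i \<in> R then q i = 0
        else \<exists>ps. simple_path T (i # q i # ps) \<and> last (i # q i # ps) \<in> R)"

end

theory Submission
  imports Defs
begin

text \<open>
  Making \<open>p \<noteq> 0\<close> the parent of \<open>i\<close> instead of leaving \<open>i\<close> a root changes the description length by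
  \<open>- N \<theta>(X\<^sub>i, X\<^sub>p)\<close>. As \<open>\<theta>\<close> is symmetric, the description length of a forest model is a constant
  minus \<open>N\<close> times the total \<open>\<theta>\<close>-weight of its undirected edges. The claim is thus that Kruskal's
  algorithm, stopped at the first nonpositive weight, finds a forest of maximum weight. By edge
  exchange, every forest is at every stage dominated by one that contains the current edge set \<open>T\<close>
  and takes its other edges from the queue; at the end those other edges have nonpositive weight.
\<close>

section \<open>Connectivity in undirected graphs\<close>

lemma connected_in_refl [simp]: "connected_in E a a"
  by (simp add: connected_in_def)

lemma connected_in_edge: "{a, b} \<in> E \<Longrightarrow> connected_in E a b"
  by (simp add: connected_in_def r_into_rtranclp)

lemma connected_in_trans [trans]:
  "connected_in E a b \<Longrightarrow> connected_in E b c \<Longrightarrow> connected_in E a c"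
  by (simp add: connected_in_def)

lemma connected_in_step: "{a, b} \<in> E \<Longrightarrow> connected_in E b c \<Longrightarrow> connected_in E a c"
  by (rule connected_in_trans[OF connected_in_edge])

lemma connected_in_sym: "connected_in E a b \<Longrightarrow> connected_in E b a"
proof -
  have "symp (\<lambda>a b. {a, b} \<in> E)"
    by (simp add: symp_def insert_commute)
  then show "connected_in E a b \<Longrightarrow> connected_in E b a"
    unfolding connected_in_def by (metis symp_rtranclp sympD)
qed

lemma connected_in_mono:
  assumes "connected_in E a b" "E \<subseteq> F"
  shows "connected_in F a b"
proof -
  have "(\<lambda>a b. {a, b} \<in> E)\<^sup>*\<^sup>* \<le> (\<lambda>a b. {a, b} \<in> F)\<^sup>*\<^sup>*"
    by (rule rtranclp_mono) (use assms(2) in auto)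
  then show ?thesis
    using assms(1) unfolding connected_in_def by blast
qed

text \<open>A set that no edge leaves traps every path starting in it. Later reachability claims
  reduce to a choice of such a set \<open>S\<close>.\<close>

lemma connected_in_closed:
  assumes "connected_in E a b" "a \<in> S"
    and "\<And>x y. {x, y} \<in> E \<Longrightarrow> x \<in> S \<Longrightarrow> y \<in> S"
  shows "b \<in> S"
  using assms(1) unfolding connected_in_def
  by (induction rule: rtranclp_induct) (use assms(2,3) in blast)+

text \<open>A path need not use the new edge more than once, and then in one of two directions.
  Formally, the right-hand side, as a set of endpoints \<open>b\<close>, is closed under the edges
  of the enlarged graph.\<close>

lemma connected_in_insert:
  "connected_in (insert {i, j} E) a b \<longleftrightarrow>
     connected_in E a b \<or> connected_in E a i \<and> connected_in E j b \<or>
     connected_in E a j \<and> connected_in E i b"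
  (is "?L \<longleftrightarrow> ?P b")
proof
  assume ?L
  then have "b \<in> {b. ?P b}"
  proof (rule connected_in_closed)
    fix x y
    assume e: "{x, y} \<in> insert {i, j} E" and x: "x \<in> {b. ?P b}"
    show "y \<in> {b. ?P b}"
    proof (cases "{x, y} \<in> E")
      case True
      then show ?thesis using x connected_in_edge connected_in_trans by blast
    next
      case False
      then have "x = i \<and> y = j \<or> x = j \<and> y = i"
        using e by (auto simp: doubleton_eq_iff)
      then show ?thesis using x connected_in_refl connected_in_trans by blast
    qed
  qed simp
  then show "?P b" by simp
next
  have sub: "E \<subseteq> insert {i, j} E" by blast
  have "connected_in (insert {i, j} E) i j" by (simp add: connected_in_edge)
  then show "?P b \<Longrightarrow> ?L"
    by (meson connected_in_mono[OF _ sub] connected_in_sym connected_in_trans)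
qed

section \<open>Undirected forests\<close>

definition complete_edges :: "nat \<Rightarrow> nat set set" where
  "complete_edges n = {{a, b} | a b. 1 \<le> a \<and> a < b \<and> b \<le> n}"

text \<open>
  Acyclicity of an undirected edge set is expressed by requiring that each edge be a bridge.
\<close>

definition bridged :: "nat set set \<Rightarrow> bool" where
  "bridged E \<longleftrightarrow> (\<forall>a b. {a, b} \<in> E \<longrightarrow> \<not> connected_in (E - {{a, b}}) a b)"

definition forest :: "nat \<Rightarrow> nat set set \<Rightarrow> bool" where
  "forest n E \<longleftrightarrow> E \<subseteq> complete_edges n \<and> bridged E"

lemma complete_edges_iff:
  "{a, b} \<in> complete_edges n \<longleftrightarrow> a \<in> {1..n} \<and> b \<in> {1..n} \<and> a \<noteq> b"
proof
  assume "{a, b} \<in> complete_edges n"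
  then show "a \<in> {1..n} \<and> b \<in> {1..n} \<and> a \<noteq> b"
    by (auto simp: complete_edges_def doubleton_eq_iff)
next
  assume "a \<in> {1..n} \<and> b \<in> {1..n} \<and> a \<noteq> b"
  then have "{min a b, max a b} = {a, b}" "1 \<le> min a b" "min a b < max a b" "max a b \<le> n"
    by (auto simp: min_def max_def)
  then show "{a, b} \<in> complete_edges n"
    unfolding complete_edges_def by blast
qed

lemma finite_complete_edges: "finite (complete_edges n)"
proof -
  have "complete_edges n \<subseteq> Pow {1..n}" by (auto simp: complete_edges_def)
  then show ?thesis by (rule finite_subset) simp
qed

lemma forest_finite: "forest n E \<Longrightarrow> finite E"
  using finite_complete_edges finite_subset unfolding forest_def by blast

lemma bridgedD: "bridged E \<Longrightarrow> {a, b} \<in> E \<Longrightarrow> \<not> connected_in (E - {{a, b}}) a b"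
  by (simp add: bridged_def)

lemma bridged_subset:
  assumes "bridged E" "F \<subseteq> E"
  shows "bridged F"
  unfolding bridged_def
proof (intro allI impI notI)
  fix a b assume e: "{a, b} \<in> F" and c: "connected_in (F - {{a, b}}) a b"
  have "connected_in (E - {{a, b}}) a b"
    by (rule connected_in_mono[OF c]) (use assms(2) in blast)
  then show False using e assms bridgedD by blast
qed

text \<open>If an old edge \<open>{a, b}\<close> could be bypassed, the detour would have to run
  through \<open>{i, j}\<close>. The two remaining pieces of the detour, joined by
  \<open>{a, b}\<close> itself, would then connect \<open>i\<close> with \<open>j\<close> inside
  \<open>E\<close>.\<close>

lemma bridged_insert:
  assumes E: "bridged E" and ij: "\<not> connected_in E i j"
  shows "bridged (insert {i, j} E)"
  unfolding bridged_def
proof (intro allI impI notI)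
  fix a b
  assume e: "{a, b} \<in> insert {i, j} E" and c: "connected_in (insert {i, j} E - {{a, b}}) a b"
  show False
  proof (cases "{a, b} = {i, j}")
    case True
    have "connected_in E a b"
      by (rule connected_in_mono[OF c]) (use True in blast)
    then show False
      using True ij connected_in_sym by (metis doubleton_eq_iff)
  next
    case False
    then have ab: "{a, b} \<in> E" using e by simp
    have nc: "\<not> connected_in (E - {{a, b}}) a b" using E ab bridgedD by blast
    have "insert {i, j} E - {{a, b}} = insert {i, j} (E - {{a, b}})" using False by blast
    then have d: "connected_in (E - {{a, b}}) a i \<and> connected_in (E - {{a, b}}) j b \<or>
        connected_in (E - {{a, b}}) a j \<and> connected_in (E - {{a, b}}) i b"
      using c nc by (simp add: connected_in_insert)
    have sub: "E - {{a, b}} \<subseteq> E" by blast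
    have "connected_in E a b" using ab connected_in_edge by blast
    then have "connected_in E i j"
      using d by (meson connected_in_mono[OF _ sub] connected_in_sym connected_in_trans)
    then show False using ij by blast
  qed
qed

section \<open>Edge exchange\<close>

lemma last_exit:
  assumes "connected_in E i j" "i \<in> W" "j \<notin> W"
  obtains u v where "u \<in> W" "v \<notin> W" "{u, v} \<in> E" "connected_in (E - {{u, v}}) v j"
proof -
  \<comment> \<open>After its last exit from \<open>W\<close> a path uses only edges with no end in
    \<open>W\<close>; none of these is the exit edge \<open>{u, v}\<close>, since \<open>u\<close>
    lies in \<open>W\<close>.\<close>
  define out where "out = {e \<in> E. e \<inter> W = {}}"
  \<comment> \<open>The path is read backwards from \<open>j\<close>: either \<open>W\<close> has
    not been met yet, or its last exit has been found.\<close>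
  have "i \<notin> W \<and> connected_in out i j \<or>
      (\<exists>u v. u \<in> W \<and> v \<notin> W \<and> {u, v} \<in> E \<and> connected_in out v j)"
    using assms(1) unfolding connected_in_def[of E]
  proof (induction rule: converse_rtranclp_induct)
    case base
    then show ?case using assms(3) by simp
  next
    case (step x y)
    show ?case
    proof (cases "y \<notin> W \<and> connected_in out y j")
      case False
      then show ?thesis using step.IH by blast
    next
      case y: True
      show ?thesis
      proof (cases "x \<in> W")
        case True
        then show ?thesis using y step.hyps by blast
      next
        case False
        then have "{x, y} \<in> out" using y step.hyps by (simp add: out_def)
        then show ?thesis
          using False y connected_in_edge connected_in_trans by blast
      qed
    qed
  qed
  then obtain u v where uv: "u \<in> W" "v \<notin> W" "{u, v} \<in> E" "connected_in out v j"
    using assms(2) by blast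
  have "connected_in (E - {{u, v}}) v j"
    by (rule connected_in_mono[OF uv(4)]) (use uv(1) in \<open>auto simp: out_def\<close>)
  then show ?thesis using that uv by blast
qed

text \<open>
  Since the component \<open>W\<close> of \<open>i\<close> in \<open>T\<close> is connected without the edge by which a path of \<open>F\<close>
  leaves it for the last time, that edge separates \<open>i\<close> from \<open>j\<close> in \<open>F\<close>.
\<close>

lemma bridged_exchange:
  assumes F: "bridged F" "T \<subseteq> F" and c: "connected_in F i j" and nc: "\<not> connected_in T i j"
  obtains f where "f \<in> F - T" "bridged (insert {i, j} (F - {f}))"
proof -
  define W where "W = {x. connected_in T i x}"
  have W: "i \<in> W" "j \<notin> W" using nc by (auto simp: W_def)
  obtain u v where uv: "u \<in> W" "v \<notin> W" "{u, v} \<in> F" "connected_in (F - {{u, v}}) v j"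
    using last_exit[OF c W] by blast
  have nT: "{u, v} \<notin> T"
    using uv(1,2) connected_in_edge connected_in_trans unfolding W_def by blast
  have iu: "connected_in (F - {{u, v}}) i u"
    by (rule connected_in_mono[of T]) (use uv(1) nT F(2) in \<open>auto simp: W_def\<close>)
  have "\<not> connected_in (F - {{u, v}}) i j"
  proof
    assume "connected_in (F - {{u, v}}) i j"
    then have "connected_in (F - {{u, v}}) u v"
      using iu uv(4) connected_in_sym connected_in_trans by meson
    then show False using bridgedD[OF F(1) uv(3)] by blast
  qed
  moreover have "bridged (F - {{u, v}})" using F(1) by (rule bridged_subset) blast
  ultimately have "bridged (insert {i, j} (F - {{u, v}}))" by (rule bridged_insert[rotated])
  then show ?thesis using that nT uv(3) by blast
qed

subsection \<open>Kruskal's algorithm\<close>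

text \<open>\<open>Min\<close> and \<open>Max\<close> recover the ordered pair by which the queue
  represents an edge. Symmetry of the statistic enters later, in \<open>sum_links\<close>.\<close>

definition edge_weight :: "(nat \<Rightarrow> nat \<Rightarrow> real) \<Rightarrow> nat set \<Rightarrow> real" where
  "edge_weight \<theta> e = \<theta> (Min e) (Max e)"

lemma edge_weight_less [simp]: "i < j \<Longrightarrow> edge_weight \<theta> {i, j} = \<theta> i j"
  by (simp add: edge_weight_def)

abbreviation queue_edges :: "(nat \<times> nat) list \<Rightarrow> nat set set" where
  "queue_edges Q \<equiv> (\<lambda>(i, j). {i, j}) ` set Q"

text \<open>The blocks of \<open>V\<close> are connectivity classes of \<open>T\<close>, so the test
  for different blocks is a test for closing a cycle. The last clause bounds every forest
  \<open>F'\<close> instead of following one fixed optimum, so it yields optimality directly once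
  the loop ends.\<close>

fun greedy_inv :: "nat \<Rightarrow> (nat \<Rightarrow> nat \<Rightarrow> real) \<Rightarrow> greedy_state \<Rightarrow> bool" where
  "greedy_inv n \<theta> (Q, V, T) \<longleftrightarrow>
     set Q \<subseteq> {(i, j). 1 \<le> i \<and> i < j \<and> j \<le> n} \<and>
     (\<forall>W\<in>V. \<forall>a\<in>W. W = {b. connected_in T a b}) \<and>
     (\<forall>F'. forest n F' \<longrightarrow>
        (\<exists>F. forest n F \<and> T \<subseteq> F \<and> F - T \<subseteq> queue_edges Q \<and>
             sum (edge_weight \<theta>) F' \<le> sum (edge_weight \<theta>) F))"

lemma edge_weight_queue_le:
  assumes "set Q \<subseteq> {(i, j). 1 \<le> i \<and> i < j \<and> j \<le> n}" "e \<in> queue_edges Q"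
  shows "edge_weight \<theta> e \<le> max_weight \<theta> Q"
proof -
  obtain k l where kl: "(k, l) \<in> set Q" "e = {k, l}" using assms(2) by auto
  then have "k < l" using assms(1) by auto
  moreover have "\<theta> k l \<le> max_weight \<theta> Q"
    unfolding max_weight_def by (rule Max_ge) (use kl(1) in \<open>auto intro: rev_image_eqI\<close>)
  ultimately show ?thesis using kl(2) by simp
qed

lemma queue_edges_remove1:
  "queue_edges Q - {{i, j}} \<subseteq> queue_edges (remove1 (i, j) Q)"
proof
  fix e assume "e \<in> queue_edges Q - {{i, j}}"
  then obtain k l where "(k, l) \<in> set Q" "e = {k, l}" "(k, l) \<noteq> (i, j)" by auto
  then show "e \<in> queue_edges (remove1 (i, j) Q)"
    by (auto intro!: rev_image_eqI[of "(k, l)"] simp: in_set_remove1)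
qed

text \<open>The edge \<open>{i, j}\<close> already lies in \<open>F\<close>, can be added to
  \<open>F\<close>, or closes a cycle in \<open>F\<close>. Positivity of its weight settles the
  second case. In the third, the edge given up lies in \<open>F - T\<close>, hence in the queue, so
  by maximality it is no heavier. The bound \<open>G \<subseteq> insert {i, j} F\<close> keeps the
  edges outside the new \<open>T\<close> in the queue.\<close>

lemma forest_extend:
  assumes F: "forest n F" "T \<subseteq> F" "F - T \<subseteq> queue_edges Q"
    and Q: "set Q \<subseteq> {(i, j). 1 \<le> i \<and> i < j \<and> j \<le> n}"
    and ij: "(i, j) \<in> set Q" "\<theta> i j = max_weight \<theta> Q" "0 < \<theta> i j" "\<not> connected_in T i j"
  obtains G where "forest n G" "insert {i, j} T \<subseteq> G" "G \<subseteq> insert {i, j} F"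
    "sum (edge_weight \<theta>) F \<le> sum (edge_weight \<theta>) G"
proof -
  have lt: "1 \<le> i" "i < j" "j \<le> n" using Q ij(1) by auto
  have e: "{i, j} \<in> complete_edges n" using lt by (auto simp: complete_edges_iff)
  have w: "edge_weight \<theta> {i, j} = \<theta> i j" using lt by simp
  have br: "bridged F" and FE: "F \<subseteq> complete_edges n" using F(1) by (auto simp: forest_def)
  have fin: "finite F" using F(1) by (rule forest_finite)
  consider "{i, j} \<in> F" | "{i, j} \<notin> F" "\<not> connected_in F i j" | "{i, j} \<notin> F" "connected_in F i j"
    by blast
  then show ?thesis
  proof cases
    case 1
    then show ?thesis using that[of F] F by auto
  next
    case 2
    have "forest n (insert {i, j} F)"
      using bridged_insert[OF br 2(2)] e FE by (simp add: forest_def)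
    then show ?thesis
      using that[of "insert {i, j} F"] F(2) fin 2(1) w ij(3) by auto
  next
    case 3
    obtain f where f: "f \<in> F - T" "bridged (insert {i, j} (F - {f}))"
      using bridged_exchange[OF br F(2) 3(2) ij(4)] by blast
    have "forest n (insert {i, j} (F - {f}))"
      using f(2) e FE by (auto simp: forest_def)
    moreover have "edge_weight \<theta> f \<le> edge_weight \<theta> {i, j}"
      using edge_weight_queue_le[OF Q subsetD[OF F(3) f(1)]] w ij(2) by simp
    then have "sum (edge_weight \<theta>) F \<le> sum (edge_weight \<theta>) (insert {i, j} (F - {f}))"
      using fin 3(1) f(1) by (simp add: sum_diff1)
    ultimately show ?thesis
      using that[of "insert {i, j} (F - {f})"] F(2) f(1) by blast
  qed
qed

text \<open>Blocks are whole classes, so a surviving block other than \<open>W1\<close> and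
  \<open>W2\<close> contains neither \<open>i\<close> nor \<open>j\<close>, and the new edge does
  not change what its nodes reach.\<close>

lemma components_merge:
  assumes V: "\<forall>W\<in>V. \<forall>a\<in>W. W = {b. connected_in T a b}"
    and W: "W1 \<in> V" "W2 \<in> V" "i \<in> W1" "j \<in> W2"
    and U: "U \<in> insert (W1 \<union> W2) (V - {W1, W2})" "a \<in> U"
  shows "U = {b. connected_in (insert {i, j} T) a b}"
proof -
  have W1: "W1 = {b. connected_in T i b}" and W2: "W2 = {b. connected_in T j b}"
    using V W by blast+
  have eq: "connected_in T a b \<longleftrightarrow> connected_in T a' b" if "connected_in T a a'" for a a' b
    using that connected_in_sym connected_in_trans by meson
  show ?thesis
  proof (cases "U = W1 \<union> W2")
    case True
    then consider "connected_in T i a" | "connected_in T j a" using U(2) W1 W2 by blast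
    then show ?thesis
    proof cases
      case 1
      then have "connected_in T a i" "\<And>b. connected_in T a b \<longleftrightarrow> connected_in T i b"
        using connected_in_sym eq by blast+
      then show ?thesis unfolding True connected_in_insert W1 W2 by blast
    next
      case 2
      then have "connected_in T a j" "\<And>b. connected_in T a b \<longleftrightarrow> connected_in T j b"
        using connected_in_sym eq by blast+
      then show ?thesis unfolding True connected_in_insert W1 W2 by blast
    qed
  next
    case False
    then have UV: "U \<in> V" "U \<noteq> W1" "U \<noteq> W2" using U(1) by auto
    then have "U = {b. connected_in T a b}" using V U(2) by blast
    moreover have "\<not> connected_in T a i" "\<not> connected_in T a j"
      using UV U(2) V W calculation by (metis mem_Collect_eq)+
    ultimately show ?thesis by (simp add: connected_in_insert)
  qed
qed

lemma greedy_inv_step: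
  assumes "greedy_step \<theta> s s'" "greedy_inv n \<theta> s"
  shows "greedy_inv n \<theta> s'"
  using assms
proof (induction rule: greedy_step.induct)
  case (merge Q i j W1 V W2 T)
  then have Q: "set Q \<subseteq> {(i, j). 1 \<le> i \<and> i < j \<and> j \<le> n}"
    and V: "\<forall>W\<in>V. \<forall>a\<in>W. W = {b. connected_in T a b}"
    and ex: "\<And>F'. forest n F' \<Longrightarrow> \<exists>F. forest n F \<and> T \<subseteq> F \<and> F - T \<subseteq> queue_edges Q \<and>
             sum (edge_weight \<theta>) F' \<le> sum (edge_weight \<theta>) F"
    by auto
  have pos: "0 < \<theta> i j" using merge by (simp add: loop_guard_def)
  have nc: "\<not> connected_in T i j"
  proof
    assume "connected_in T i j"
    then have "j \<in> W1" using V merge by blast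
    then show False using V merge by blast
  qed
  have "\<exists>G. forest n G \<and> insert {i, j} T \<subseteq> G \<and>
      G - insert {i, j} T \<subseteq> queue_edges (remove1 (i, j) Q) \<and>
      sum (edge_weight \<theta>) F' \<le> sum (edge_weight \<theta>) G" if "forest n F'" for F'
  proof -
    obtain F where F: "forest n F" "T \<subseteq> F" "F - T \<subseteq> queue_edges Q"
      "sum (edge_weight \<theta>) F' \<le> sum (edge_weight \<theta>) F"
      using ex \<open>forest n F'\<close> by blast
    obtain G where G: "forest n G" "insert {i, j} T \<subseteq> G" "G \<subseteq> insert {i, j} F"
      "sum (edge_weight \<theta>) F \<le> sum (edge_weight \<theta>) G"
      using forest_extend[OF F(1-3) Q merge.hyps(2,3) pos nc] by blast
    have "G - insert {i, j} T \<subseteq> queue_edges Q - {{i, j}}" using G(3) F(3) by blast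
    then show ?thesis using G F(4) queue_edges_remove1 by (meson order_trans)
  qed
  moreover have "set (remove1 (i, j) Q) \<subseteq> {(i, j). 1 \<le> i \<and> i < j \<and> j \<le> n}"
    using set_remove1_subset Q by (rule order_trans)
  moreover have "\<forall>U\<in>insert (W1 \<union> W2) (V - {W1, W2}).
      \<forall>a\<in>U. U = {b. connected_in (insert {i, j} T) a b}"
    using components_merge[OF V merge.hyps(4-7)] by blast
  ultimately show ?case unfolding greedy_inv.simps by (intro conjI allI impI)
next
  case (skip Q i j W V T)
  then have Q: "set Q \<subseteq> {(i, j). 1 \<le> i \<and> i < j \<and> j \<le> n}"
    and V: "\<forall>W\<in>V. \<forall>a\<in>W. W = {b. connected_in T a b}"
    and ex: "\<And>F'. forest n F' \<Longrightarrow> \<exists>F. forest n F \<and> T \<subseteq> F \<and> F - T \<subseteq> queue_edges Q \<and>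
             sum (edge_weight \<theta>) F' \<le> sum (edge_weight \<theta>) F"
    by auto
  have c: "connected_in T i j" using V skip by blast
  have keep: "F - T \<subseteq> queue_edges (remove1 (i, j) Q)"
    if F: "forest n F" "T \<subseteq> F" "F - T \<subseteq> queue_edges Q" for F
  proof -
    \<comment> \<open>\<open>T\<close> already joins \<open>i\<close> and \<open>j\<close>, so as an
      edge of \<open>F\<close> outside \<open>T\<close> this pair would not be a bridge. Dropping it
      from the queue loses nothing.\<close>
    have "{i, j} \<notin> F - T"
    proof
      assume e: "{i, j} \<in> F - T"
      have "connected_in (F - {{i, j}}) i j"
        by (rule connected_in_mono[OF c]) (use e F(2) in blast)
      then show False using F(1) e bridgedD by (auto simp: forest_def)
    qed
    then have "F - T \<subseteq> queue_edges Q - {{i, j}}" using F(3) by blast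
    then show ?thesis using queue_edges_remove1 by (meson order_trans)
  qed
  have "\<exists>F. forest n F \<and> T \<subseteq> F \<and> F - T \<subseteq> queue_edges (remove1 (i, j) Q) \<and>
      sum (edge_weight \<theta>) F' \<le> sum (edge_weight \<theta>) F" if "forest n F'" for F'
    using ex[OF that] keep by meson
  moreover have "set (remove1 (i, j) Q) \<subseteq> {(i, j). 1 \<le> i \<and> i < j \<and> j \<le> n}"
    using set_remove1_subset Q by (rule order_trans)
  ultimately show ?case using V unfolding greedy_inv.simps by (intro conjI allI impI)
qed

theorem greedy_output_optimal:
  assumes "greedy_output n \<theta> T"
  shows "forest n T"
    and "forest n F' \<Longrightarrow> sum (edge_weight \<theta>) F' \<le> sum (edge_weight \<theta>) T"
proof -
  obtain Q0 Q V where Q0: "sorted_queue n \<theta> Q0"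
    and steps: "(greedy_step \<theta>)\<^sup>*\<^sup>* (Q0, (\<lambda>i. {i}) ` {1..n}, {}) (Q, V, T)"
    and stop: "\<not> loop_guard \<theta> Q"
    using assms unfolding greedy_output_def by blast
  have conn_empty: "Collect (connected_in {} a) = {a}" for a
    using connected_in_closed[of "{}" a _ "{a}"] by auto
  \<comment> \<open>Initially all edges are in the queue, so every forest is its own dominating
    forest.\<close>
  have "complete_edges n \<subseteq> queue_edges Q0"
    using Q0 by (auto simp: sorted_queue_def complete_edges_def intro!: rev_image_eqI)
  then have "\<exists>F. forest n F \<and> {} \<subseteq> F \<and> F - {} \<subseteq> queue_edges Q0 \<and>
      sum (edge_weight \<theta>) F' \<le> sum (edge_weight \<theta>) F" if "forest n F'" for F'
    using that unfolding forest_def by (intro exI[of _ F']) auto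
  then have init: "greedy_inv n \<theta> (Q0, (\<lambda>i. {i}) ` {1..n}, {})"
    using Q0 by (simp add: sorted_queue_def conn_empty)
  from steps have "greedy_inv n \<theta> (Q, V, T)"
    by (induction rule: rtranclp_induct) (rule init, rule greedy_inv_step)
  then have Q: "set Q \<subseteq> {(i, j). 1 \<le> i \<and> i < j \<and> j \<le> n}"
    and ex: "\<And>F'. forest n F' \<Longrightarrow> \<exists>F. forest n F \<and> T \<subseteq> F \<and> F - T \<subseteq> queue_edges Q \<and>
             sum (edge_weight \<theta>) F' \<le> sum (edge_weight \<theta>) F"
    by auto
  \<comment> \<open>Applied to the empty forest, the invariant gives a forest containing
    \<open>T\<close>, and \<open>T\<close> inherits its bridges.\<close>
  have "forest n {}" by (simp add: forest_def bridged_def)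
  then show "forest n T"
    using ex bridged_subset unfolding forest_def by (meson order_trans)
  assume "forest n F'"
  then obtain F where F: "forest n F" "T \<subseteq> F" "F - T \<subseteq> queue_edges Q"
    "sum (edge_weight \<theta>) F' \<le> sum (edge_weight \<theta>) F"
    using ex by blast
  have "edge_weight \<theta> e \<le> 0" if "e \<in> F - T" for e
  proof -
    have "e \<in> queue_edges Q" using that F(3) by blast
    \<comment> \<open>The guard also fails on an empty queue, where \<open>max_weight\<close> is an
      unspecified \<open>Max\<close>; the edge \<open>e\<close> excludes this case.\<close>
    moreover from this have "Q \<noteq> []" by auto
    ultimately show ?thesis
      using edge_weight_queue_le[OF Q, of e \<theta>] stop by (auto simp: loop_guard_def)
  qed
  then have "sum (edge_weight \<theta>) (F - T) \<le> 0" by (rule sum_nonpos)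
  moreover have "sum (edge_weight \<theta>) F = sum (edge_weight \<theta>) (F - T) + sum (edge_weight \<theta>) T"
    using F(2) forest_finite[OF F(1)] by (rule sum.subset_diff)
  ultimately show "sum (edge_weight \<theta>) F' \<le> sum (edge_weight \<theta>) T" using F(4) by linarith
qed

subsection \<open>Rooted and undirected forests\<close>

lemma dep_forest_forest:
  assumes "dep_forest n q"
  shows "forest n (undirected_links n q)"
proof -
  define r where "r = {(q i, i) | i. i \<in> {1..n} \<and> q i \<noteq> 0}"
  have ac: "acyclic r" and q: "\<And>i. i \<in> {1..n} \<Longrightarrow> q i \<in> {0..n} \<and> q i \<noteq> i"
    using assms by (auto simp: dep_forest_def r_def)
  have "\<not> connected_in (undirected_links n q - {{q i, i}}) i (q i)"
    if i: "i \<in> {1..n}" "q i \<noteq> 0" for i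
  proof
    assume c: "connected_in (undirected_links n q - {{q i, i}}) i (q i)"
    \<comment> \<open>The link into \<open>i\<close> is the only edge that leaves the set of descendants of \<open>i\<close>.\<close>
    have "q i \<in> {x. (i, x) \<in> r\<^sup>*}"
    proof (rule connected_in_closed[OF c])
      fix x y
      assume xy: "{x, y} \<in> undirected_links n q - {{q i, i}}" and x: "x \<in> {x. (i, x) \<in> r\<^sup>*}"
      then obtain k where k: "k \<in> {1..n}" "q k \<noteq> 0" "{x, y} = {q k, k}" "k \<noteq> i"
        by (auto simp: undirected_links_def)
      then have kr: "(q k, k) \<in> r" by (auto simp: r_def)
      from k(3) consider "x = q k" "y = k" | "x = k" "y = q k"
        by (auto simp: doubleton_eq_iff)
      then show "y \<in> {x. (i, x) \<in> r\<^sup>*}"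
      proof cases
        case 1
        then show ?thesis using x kr by (auto intro: rtrancl_into_rtrancl)
      next
        case 2
        \<comment> \<open>Since \<open>k\<close> is a descendant of \<open>i\<close> other than
          \<open>i\<close>, the path from \<open>i\<close> reaches it through its only parent
          \<open>q k\<close>, which is thus a descendant too.\<close>
        then have "(i, k) \<in> r\<^sup>*" using x by simp
        then obtain z where "(i, z) \<in> r\<^sup>*" "(z, k) \<in> r" using k(4) by (auto elim: rtranclE)
        then show ?thesis using 2 by (auto simp: r_def)
      qed
    qed simp
    then have "(i, q i) \<in> r\<^sup>*" by simp
    moreover have "(q i, i) \<in> r" using i by (auto simp: r_def)
    ultimately have "(i, i) \<in> r\<^sup>+" by (rule rtrancl_into_trancl1)
    then show False using ac by (auto simp: acyclic_def)
  qed
  then have "bridged (undirected_links n q)"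
    unfolding bridged_def
    by (auto simp: undirected_links_def doubleton_eq_iff insert_commute dest: connected_in_sym)
  moreover have "undirected_links n q \<subseteq> complete_edges n"
    using q by (fastforce simp: undirected_links_def complete_edges_iff)
  ultimately show ?thesis by (simp add: forest_def)
qed

text \<open>A simple path never returns to its first node \<open>i\<close>. Its remainder therefore
  survives the removal of any edge at \<open>i\<close>, which is how the cuts below use it.\<close>

lemma simple_path_connected:
  assumes "simple_path T (i # ps)" "ps \<noteq> []"
  shows "connected_in {e \<in> T. i \<notin> e} (hd ps) (last ps)"
proof -
  have path: "successively (\<lambda>a b. {a, b} \<in> T) ps \<Longrightarrow> ps \<noteq> [] \<Longrightarrow> i \<notin> set ps \<Longrightarrow>
      connected_in {e \<in> T. i \<notin> e} (hd ps) (last ps)" for ps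
  proof (induction ps)
    case (Cons a ps)
    show ?case
    proof (cases ps)
      case (Cons b qs)
      have "{a, b} \<in> {e \<in> T. i \<notin> e}" using Cons.prems Cons by auto
      then show ?thesis using Cons.prems Cons.IH Cons connected_in_edge connected_in_trans
        by (metis (no_types, lifting) last_ConsR list.distinct(1) list.sel(1) list.set_intros(2)
            successively.simps(3))
    qed simp
  qed simp
  show ?thesis using path[of ps] assms by (auto simp: simple_path_def successively_Cons)
qed

lemma parent_function_step:
  assumes "parent_function n T R q" "i \<in> {1..n}" "i \<notin> R"
  obtains r where "{q i, i} \<in> T" "r \<in> R" "connected_in {e \<in> T. i \<notin> e} (q i) r"
proof -
  obtain ps where ps: "simple_path T (i # q i # ps)" "last (i # q i # ps) \<in> R"
    using assms unfolding parent_function_def by metis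
  have "connected_in {e \<in> T. i \<notin> e} (q i) (last (q i # ps))"
    using simple_path_connected[OF ps(1)] by simp
  moreover have "{q i, i} \<in> T" using ps(1) by (simp add: simple_path_def insert_commute)
  ultimately show ?thesis using that ps(2) by simp
qed

text \<open>Cutting a bridge of \<open>T\<close> leaves the root on one side; the end on the other
  side must have the opposite end as its parent, so every edge is a link. A directed cycle of links
  would bypass a bridge.\<close>

theorem parent_function_dep_forest:
  assumes T: "forest n T" and R: "root_choice n T R" and q: "parent_function n T R q"
  shows "dep_forest n q" and "undirected_links n q = T"
proof -
  have TE: "T \<subseteq> complete_edges n" and br: "bridged T" using T by (auto simp: forest_def)
  have ends: "a \<in> {1..n} \<and> b \<in> {1..n} \<and> a \<noteq> b" if "{a, b} \<in> T" for a b
    using subsetD[OF TE that] complete_edges_iff by blast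
  have root: "q i = 0" if "i \<in> R" for i
    using that R q by (auto simp: root_choice_def parent_function_def)
  have nonroot: "\<exists>r. {q i, i} \<in> T \<and> q i \<in> {1..n} \<and> q i \<noteq> i \<and> r \<in> R \<and>
      connected_in {e \<in> T. i \<notin> e} (q i) r" if "i \<in> {1..n}" "i \<notin> R" for i
  proof -
    obtain r where "{q i, i} \<in> T" "r \<in> R" "connected_in {e \<in> T. i \<notin> e} (q i) r"
      using parent_function_step[OF q \<open>i \<in> {1..n}\<close> \<open>i \<notin> R\<close>] .
    then show ?thesis using ends[of "q i" i] by blast
  qed
  have edge: "{q i, i} \<in> T" if "i \<in> {1..n}" "q i \<noteq> 0" for i
    using nonroot[of i] root[of i] that by blast
  have uniq: "r = r'" if "connected_in T a r" "connected_in T a r'" "r \<in> R" "r' \<in> R" "a \<in> {1..n}"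
    for a r r' using R that unfolding root_choice_def by blast
  \<comment> \<open>If the parent of \<open>a\<close> were not \<open>b\<close>, then
    \<open>a\<close> would also reach \<open>r\<close> without \<open>{a, b}\<close>: either
    \<open>a\<close> is itself the root \<open>r\<close>, or its path to the root, which is
    \<open>r\<close> by uniqueness, starts with another edge. Via \<open>r\<close> the bridge would
    be bypassed.\<close>
  have parent: "q a = b"
    if ab: "{a, b} \<in> T" and r: "r \<in> R" "connected_in (T - {{a, b}}) b r" for a b r
  proof (rule ccontr)
    assume ne: "q a \<noteq> b"
    have a: "a \<in> {1..n}" using ends[OF ab] by blast
    have sub: "T - {{a, b}} \<subseteq> T" by blast
    have ar: "connected_in T a r"
      by (rule connected_in_step[OF ab connected_in_mono[OF r(2) sub]])
    have "connected_in (T - {{a, b}}) a r"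
    proof (cases "a \<in> R")
      case True
      then show ?thesis using uniq[OF _ ar] r(1) a by (metis connected_in_refl)
    next
      case False
      obtain r' where r': "{q a, a} \<in> T" "r' \<in> R" "connected_in {e \<in> T. a \<notin> e} (q a) r'"
        using nonroot[OF a False] by blast
      have "{a, q a} \<in> T - {{a, b}}"
        using r'(1) ne by (auto simp: insert_commute doubleton_eq_iff)
      moreover have "connected_in (T - {{a, b}}) (q a) r'"
        by (rule connected_in_mono[OF r'(3)]) auto
      ultimately have c: "connected_in (T - {{a, b}}) a r'"
        by (rule connected_in_step)
      moreover have "r' = r"
        using uniq[OF connected_in_mono[OF c sub] ar r'(2) r(1) a] .
      ultimately show ?thesis by simp
    qed
    then have "connected_in (T - {{a, b}}) a b"
      by (rule connected_in_trans[OF _ connected_in_sym[OF r(2)]])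
    then show False using bridgedD[OF br ab] by blast
  qed
  have "T \<subseteq> undirected_links n q"
  proof
    fix e assume e: "e \<in> T"
    then obtain a b where ab: "e = {a, b}" "a \<in> {1..n}" "b \<in> {1..n}"
      using TE by (fastforce simp: complete_edges_def)
    obtain r where r: "r \<in> R" "connected_in T a r"
      using R ab(2) unfolding root_choice_def by blast
    \<comment> \<open>With \<open>T\<close> read as the cut graph plus one edge, the root reachable
      in \<open>T\<close> stays reachable from at least one end after the cut.\<close>
    have "insert {a, b} (T - {{a, b}}) = T" using e ab(1) by blast
    then have "connected_in (T - {{a, b}}) a r \<or> connected_in (T - {{a, b}}) b r"
      using r(2) connected_in_insert[of a b "T - {{a, b}}" a r] by auto
    then have "q a = b \<or> q b = a"
      using parent[of a b r] parent[of b a r] e ab(1) r(1) by (auto simp: insert_commute)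
    then show "e \<in> undirected_links n q"
      using ab unfolding undirected_links_def by (auto simp: insert_commute)
  qed
  moreover have "undirected_links n q \<subseteq> T"
    using edge by (auto simp: undirected_links_def)
  ultimately show "undirected_links n q = T" by blast
  \<comment> \<open>A directed two-cycle occupies a single undirected edge, so it is excluded
    separately: both ends would reach their common root without that edge.\<close>
  have no_swap: "\<not> (q j = i \<and> q i = j)" if i: "i \<in> {1..n}" and j: "j \<in> {1..n}" for i j
  proof
    assume s: "q j = i \<and> q i = j"
    then have nR: "i \<notin> R" "j \<notin> R" using root i j by auto
    obtain r where r: "r \<in> R" "connected_in {e \<in> T. i \<notin> e} j r" "{j, i} \<in> T"
      using nonroot[OF i nR(1)] s by auto
    obtain r' where r': "r' \<in> R" "connected_in {e \<in> T. j \<notin> e} i r'"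
      using nonroot[OF j nR(2)] s by auto
    have jr: "connected_in (T - {{j, i}}) j r" by (rule connected_in_mono[OF r(2)]) auto
    have ir: "connected_in (T - {{j, i}}) i r'" by (rule connected_in_mono[OF r'(2)]) auto
    have sub: "T - {{j, i}} \<subseteq> T" by blast
    have "connected_in T j r'"
      by (rule connected_in_step[OF r(3) connected_in_mono[OF ir sub]])
    then have "r = r'" using uniq[OF connected_in_mono[OF jr sub]] r(1) r'(1) j by blast
    then have "connected_in (T - {{j, i}}) j i"
      using connected_in_trans[OF _ connected_in_sym[OF ir]] jr by simp
    then show False using bridgedD[OF br r(3)] by blast
  qed
  define r where "r = {(q i, i) | i. i \<in> {1..n} \<and> q i \<noteq> 0}"
  \<comment> \<open>By \<open>no_swap\<close>, a link into a node other than \<open>i\<close> is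
    never the edge \<open>{q i, i}\<close>, so descending from \<open>i\<close> does not need the
    cut edge; a walk that returns to \<open>i\<close> simply restarts there.\<close>
  have desc: "connected_in (T - {{q i, i}}) i x"
    if i: "i \<in> {1..n}" "q i \<noteq> 0" and x: "(i, x) \<in> r\<^sup>*" for i x
    using x
  proof (induction rule: rtrancl_induct)
    case (step x y)
    then have y: "x = q y" "y \<in> {1..n}" "q y \<noteq> 0" by (auto simp: r_def)
    have "{x, y} \<in> T - {{q i, i}}" if "y \<noteq> i"
      using edge[OF y(2,3)] y no_swap[OF i(1) y(2)] that by (auto simp: doubleton_eq_iff)
    then show ?case
      using connected_in_trans[OF step.IH connected_in_edge] by (cases "y = i") auto
  qed simp
  have "acyclic r"
    unfolding acyclic_def
  proof (intro allI notI)
    fix i assume "(i, i) \<in> r\<^sup>+"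
    then obtain x where x: "(i, x) \<in> r\<^sup>*" "(x, i) \<in> r" by (meson tranclD2)
    then have i: "i \<in> {1..n}" "q i \<noteq> 0" "x = q i" by (auto simp: r_def)
    then have "connected_in (T - {{q i, i}}) (q i) i"
      using desc x(1) connected_in_sym by blast
    then show False using bridgedD[OF br edge[OF i(1,2)]] by blast
  qed
  moreover have "q i \<in> {0..n} \<and> q i \<noteq> i" if "i \<in> {1..n}" for i
    using nonroot[OF that] root that by (cases "i \<in> R") fastforce+
  ultimately show "dep_forest n q" by (simp add: dep_forest_def r_def)
qed

text \<open>Two nodes sharing a parent edge would form a directed two-cycle, so nodes with a parent
  correspond one to one to edges. Symmetry of \<open>\<theta>\<close> removes the orientation of the
  links.\<close>

lemma sum_links:
  assumes q: "dep_forest n q" and \<theta>: "\<And>i j. \<lbrakk>i \<in> {1..n}; j \<in> {1..n}\<rbrakk> \<Longrightarrow> \<theta> i j = \<theta> j i"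
  shows "(\<Sum>i | i \<in> {1..n} \<and> q i \<noteq> 0. \<theta> i (q i)) = sum (edge_weight \<theta>) (undirected_links n q)"
proof -
  define I where "I = {i \<in> {1..n}. q i \<noteq> 0}"
  have ran: "q i \<in> {0..n} \<and> q i \<noteq> i" if "i \<in> {1..n}" for i
    using q that by (auto simp: dep_forest_def)
  have "inj_on (\<lambda>i. {q i, i}) I"
  proof (rule inj_onI, rule ccontr)
    fix i j assume ij: "i \<in> I" "j \<in> I" "{q i, i} = {q j, j}" "i \<noteq> j"
    then have "q i = j" "q j = i" by (auto simp: doubleton_eq_iff)
    then have "(j, i) \<in> {(q i, i) | i. i \<in> {1..n} \<and> q i \<noteq> 0}"
      "(i, j) \<in> {(q i, i) | i. i \<in> {1..n} \<and> q i \<noteq> 0}"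
      using ij by (auto simp: I_def)
    then have "(i, i) \<in> {(q i, i) | i. i \<in> {1..n} \<and> q i \<noteq> 0}\<^sup>+"
      by (meson r_into_trancl trancl_into_trancl)
    then show False using q by (auto simp: dep_forest_def acyclic_def)
  qed
  moreover have "undirected_links n q = (\<lambda>i. {q i, i}) ` I"
    by (auto simp: undirected_links_def I_def)
  moreover have "edge_weight \<theta> {q i, i} = \<theta> i (q i)" if "i \<in> I" for i
    using that ran[of i] \<theta>[of i "q i"]
    by (auto simp: I_def edge_weight_def min_def max_def)
  ultimately show ?thesis
    by (simp add: sum.reindex I_def)
qed

subsection \<open>Description length as edge weight\<close>

lemma freq2_swap: "freq2 xs i j a b = freq2 xs j i b a"
  by (simp add: freq2_def conj_commute)

lemma freq2_marginal:
  assumes "finite B" "\<And>x. x \<in> set xs \<Longrightarrow> x j \<in> B"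
  shows "(\<Sum>b\<in>B. freq2 xs i j a b) = freq xs i a"
proof -
  have "{t. t < length xs \<and> (xs ! t) i = a} =
      (\<Union>b\<in>B. {t. t < length xs \<and> (xs ! t) i = a \<and> (xs ! t) j = b})"
    using assms(2) by auto
  moreover have "card (\<Union>b\<in>B. {t. t < length xs \<and> (xs ! t) i = a \<and> (xs ! t) j = b}) =
      (\<Sum>b\<in>B. card {t. t < length xs \<and> (xs ! t) i = a \<and> (xs ! t) j = b})"
    by (rule card_UN_disjoint) (use assms(1) in auto)
  ultimately show ?thesis by (simp add: freq_def freq2_def)
qed

lemma freq2_pos_freq:
  assumes "freq2 xs i j a b \<noteq> 0"
  shows "freq2 xs i j a b > 0" "freq xs i a > 0" "freq xs j b > 0"
proof -
  show "freq2 xs i j a b > 0" using assms by (simp add: freq2_def card_gt_0_iff)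
  then have "{t. t < length xs \<and> (xs ! t) i = a \<and> (xs ! t) j = b} \<noteq> {}"
    by (auto simp: freq2_def card_gt_0_iff)
  then show "freq xs i a > 0" "freq xs j b > 0"
    by (auto simp: freq_def card_gt_0_iff)
qed

text \<open>This form is visibly symmetric in \<open>i\<close> and \<open>j\<close>, which gives
  \<open>theta_commute\<close>.\<close>

lemma mutual_info_hat_eq:
  assumes "finite (A j)" "\<And>x. x \<in> set xs \<Longrightarrow> x j \<in> A j"
  shows "mutual_info_hat A xs i j =
    (\<Sum>a\<in>A i. \<Sum>b\<in>A j. phat2 xs i j a b *
       log 2 (freq2 xs i j a b * real (length xs) / (freq xs i a * freq xs j b)))"
proof (cases "xs = []")
  case True
  then show ?thesis
    by (simp add: mutual_info_hat_def entropy_hat_def cond_entropy_hat_def phat_def phat2_def)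
next
  case False
  have "phat xs i a = (\<Sum>b\<in>A j. phat2 xs i j a b)" for a
    by (simp add: phat_def phat2_def sum_divide_distrib freq2_marginal[OF assms, symmetric])
  then have "mutual_info_hat A xs i j =
    (\<Sum>a\<in>A i. \<Sum>b\<in>A j. phat2 xs i j a b * (log 2 (phat_cond xs i j a b) - log 2 (phat xs i a)))"
    by (simp add: mutual_info_hat_def entropy_hat_def cond_entropy_hat_def
        sum_distrib_right sum_subtractf right_diff_distrib)
  also have "\<dots> = (\<Sum>a\<in>A i. \<Sum>b\<in>A j. phat2 xs i j a b *
       log 2 (freq2 xs i j a b * real (length xs) / (freq xs i a * freq xs j b)))"
  proof (intro sum.cong refl)
    fix a b
    show "phat2 xs i j a b * (log 2 (phat_cond xs i j a b) - log 2 (phat xs i a)) =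
        phat2 xs i j a b *
          log 2 (freq2 xs i j a b * real (length xs) / (freq xs i a * freq xs j b))"
    \<comment> \<open>Unobserved cells have factor 0 whatever the logarithm is; in the others all
      counts are positive and the logarithm laws apply.\<close>
    proof (cases "freq2 xs i j a b = 0")
      case True
      then show ?thesis by (simp add: phat2_def)
    next
      case nz: False
      have "real (length xs) > 0" using False by simp
      then show ?thesis using freq2_pos_freq[OF nz]
        by (simp add: phat_cond_def phat_def log_mult log_divide)
    qed
  qed
  finally show ?thesis .
qed

lemma theta_commute:
  assumes "finite (A i)" "finite (A j)"
    and "\<And>x. x \<in> set xs \<Longrightarrow> x i \<in> A i" "\<And>x. x \<in> set xs \<Longrightarrow> x j \<in> A j"
  shows "theta A xs i j = theta A xs j i"
proof -
  have "mutual_info_hat A xs i j = mutual_info_hat A xs j i"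
    using assms
    by (subst (1 2) mutual_info_hat_eq)
      (simp_all add: sum.swap[of _ "A j"] phat2_def freq2_swap[of xs j i] mult.commute)
  then show ?thesis by (simp add: theta_def mult.commute)
qed

text \<open>The reference \<open>\<lambda>_. 0\<close> is the model without links, and the
  comparison holds node by node. A parent \<open>p\<close> multiplies the parameter cost of
  \<open>i\<close> by \<open>num_vals A p\<close>, and the excess is the penalty in
  \<open>theta\<close> times the sample size; the data cost falls by the sample size times the
  mutual information.\<close>

lemma description_length_eq:
  assumes "xs \<noteq> []"
  shows "description_length n A xs q = description_length n A xs (\<lambda>_. 0)
    - real (length xs) * (\<Sum>i | i \<in> {1..n} \<and> q i \<noteq> 0. theta A xs i (q i))"
proof -
  have N: "real (length xs) > 0" using assms by simp
  have "(num_vals A i - 1) * num_vals A p / 2 * log 2 (real (length xs))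
          - log_likelihood_term A xs i p =
      (num_vals A i - 1) * num_vals A 0 / 2 * log 2 (real (length xs))
          - log_likelihood_term A xs i 0
      - (if p \<noteq> 0 then real (length xs) * theta A xs i p else 0)" for i p
  proof (cases "p = 0")
    case False
    have "real (length xs) * entropy_hat A xs i = - log_likelihood_term A xs i 0"
      using N by (simp add: entropy_hat_def log_likelihood_term_def phat_def sum_distrib_left)
    moreover have "real (length xs) * cond_entropy_hat A xs i p = - log_likelihood_term A xs i p"
      using N False
      by (simp add: cond_entropy_hat_def log_likelihood_term_def phat2_def sum_distrib_left)
    ultimately have "real (length xs) * mutual_info_hat A xs i p =
        log_likelihood_term A xs i p - log_likelihood_term A xs i 0"
      by (simp add: mutual_info_hat_def right_diff_distrib)
    moreover have "real (length xs) * theta A xs i p = real (length xs) * mutual_info_hat A xs i p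
        - (num_vals A i - 1) * (num_vals A p - 1) / 2 * log 2 (real (length xs))"
      using N by (simp add: theta_def field_simps)
    moreover have "num_vals A 0 = 1" by (simp add: num_vals_def)
    ultimately show ?thesis using False by (simp add: field_simps)
  qed simp
  then have "description_length n A xs q = description_length n A xs (\<lambda>_. 0)
      - (\<Sum>i=1..n. if q i \<noteq> 0 then real (length xs) * theta A xs i (q i) else 0)"
    unfolding description_length_def sum_subtractf[symmetric] by (intro sum.cong refl)
  also have "(\<Sum>i=1..n. if q i \<noteq> 0 then real (length xs) * theta A xs i (q i) else 0) =
      (\<Sum>i | i \<in> {1..n} \<and> q i \<noteq> 0. real (length xs) * theta A xs i (q i))"
    by (subst sum.inter_filter[symmetric]) simp_all
  finally show ?thesis by (simp add: sum_distrib_left)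
qed

theorem proposition2:
  fixes n :: nat
    and A :: "nat \<Rightarrow> 'a set"
    and xs :: "(nat \<Rightarrow> 'a) list"
    and T :: "nat set set"
    and R :: "nat set"
    and q :: "nat \<Rightarrow> nat"
  assumes "\<And>i. i \<in> {1..n} \<Longrightarrow> finite (A i) \<and> card (A i) \<ge> 1"
    and "length xs \<ge> 1"
    and "\<And>x i. x \<in> set xs \<Longrightarrow> i \<in> {1..n} \<Longrightarrow> x i \<in> A i"
    and "greedy_output n (theta A xs) T"
    and "root_choice n T R"
    and "parent_function n T R q"
  shows "dep_forest n q \<and> undirected_links n q = T \<and>
    (\<forall>q'. dep_forest n q' \<longrightarrow> description_length n A xs q \<le> description_length n A xs q')"
proof (intro conjI allI impI)
  note opt = greedy_output_optimal[OF assms(4)]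
  show q: "dep_forest n q" and links: "undirected_links n q = T"
    using parent_function_dep_forest[OF opt(1) assms(5,6)] by blast+
  have ne: "xs \<noteq> []" using assms(2) by auto
  have sym: "theta A xs i j = theta A xs j i" if "i \<in> {1..n}" "j \<in> {1..n}" for i j
    using assms(1,3) that by (intro theta_commute) auto
  have L: "description_length n A xs p = description_length n A xs (\<lambda>_. 0)
      - real (length xs) * sum (edge_weight (theta A xs)) (undirected_links n p)"
    if "dep_forest n p" for p
    unfolding description_length_eq[OF ne, of n A p] by (subst sum_links[OF that sym]) simp_all
  fix q' assume q': "dep_forest n q'"
  \<comment> \<open>Through \<open>links\<close> the weight of \<open>q\<close> is that of
    \<open>T\<close>, whatever the choice of roots.\<close>
  show "description_length n A xs q \<le> description_length n A xs q'"
    unfolding L[OF q] L[OF q'] links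
    using opt(2)[OF dep_forest_forest[OF q']] by (simp add: mult_left_mono)
qed

end
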